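(* Let $k$ be a finite field and let $f\in k[x,y]$ be an irreducible homogeneous polynomial of degree $n$, where $n\ge 3$ is odd. Among the rational functions $\mathbf P^1\to\mathbf P^1$ over $k$ of degree at most $(n-1)/2$, there is a unique function $F$ such that $(\alpha^{\#k}:1)=F((\alpha:1))$ for every root $\alpha\in\bar k$ of $f$.
   Context: An element $\alpha\in\bar k$ is a root of the homogeneous polynomial $f$ if $f(\alpha,1)=0$. The degree of a rational function $g/h$ with $g,h$ coprime homogeneous polynomials of the same degree $r$ is $r$. *)

theory Defs
  imports
    "HOL-Computational_Algebra.Computational_Algebra"
    "HOL-Algebra.Algebraic_Closure_Type"
    "HOL-Library.Cardinality"
begin

section \<open>Binary forms\<close>

text \<open>
  The ring \<open>k[x,y]\<close> is \<^typ>\<open>'a poly poly\<close>, with \<open>y\<close> the outer and \<open>x\<close> the inner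
  variable: \<open>coeff (coeff f j) i\<close> is the coefficient of \<open>x^i y^j\<close>.
  As usual, the zero polynomial is homogeneous of every degree.
\<close>

definition homogeneous :: "nat \<Rightarrow> 'a::zero poly poly \<Rightarrow> bool" where
  "homogeneous d f \<longleftrightarrow> (\<forall>i j. coeff (coeff f j) i \<noteq> 0 \<longrightarrow> i + j = d)"

definition eval_form ::
    "'a::field poly poly \<Rightarrow> 'a alg_closure \<Rightarrow> 'a alg_closure \<Rightarrow> 'a alg_closure" where
  "eval_form f a b = poly (poly (map_poly (map_poly to_ac) f) [:b:]) a"

definition form_root :: "'a::field poly poly \<Rightarrow> 'a alg_closure \<Rightarrow> bool" where
  "form_root f \<alpha> \<longleftrightarrow> eval_form f \<alpha> 1 = 0"


section \<open>The projective line\<close>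

definition proj_rel :: "'a::field \<times> 'a \<Rightarrow> 'a \<times> 'a \<Rightarrow> bool" where
  "proj_rel u v \<longleftrightarrow> u \<noteq> (0, 0) \<and> v \<noteq> (0, 0) \<and>
     (\<exists>c. c \<noteq> 0 \<and> fst v = c * fst u \<and> snd v = c * snd u)"

lemma part_equivp_proj_rel: "part_equivp (proj_rel :: 'a::field \<times> 'a \<Rightarrow> _)"
proof (rule part_equivpI)
  show "\<exists>u :: 'a \<times> 'a. proj_rel u u"
    by (intro exI[of _ "(1, 0)"]) (auto simp: proj_rel_def intro!: exI[of _ 1])
  show "symp (proj_rel :: 'a \<times> 'a \<Rightarrow> _)"
  proof (rule sympI)
    fix u v :: "'a \<times> 'a"
    assume "proj_rel u v"
    then obtain c where "u \<noteq> (0, 0)" "v \<noteq> (0, 0)" "c \<noteq> 0"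
        "fst v = c * fst u" "snd v = c * snd u"
      unfolding proj_rel_def by blast
    then show "proj_rel v u"
      unfolding proj_rel_def by (intro conjI exI[of _ "inverse c"]) auto
  qed
  show "transp (proj_rel :: 'a \<times> 'a \<Rightarrow> _)"
  proof (rule transpI)
    fix u v w :: "'a \<times> 'a"
    assume "proj_rel u v" "proj_rel v w"
    then obtain c d where "u \<noteq> (0, 0)" "w \<noteq> (0, 0)" "c \<noteq> 0" "d \<noteq> 0"
        "fst v = c * fst u" "snd v = c * snd u" "fst w = d * fst v" "snd w = d * snd v"
      unfolding proj_rel_def by blast
    then show "proj_rel u w"
      unfolding proj_rel_def by (intro conjI exI[of _ "d * c"]) auto
  qed
qed

quotient_type (overloaded) 'a proj_line = "'a::field \<times> 'a" / partial: proj_rel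
  by (rule part_equivp_proj_rel)

text \<open>\<open>proj_pt a b\<close> is the point \<open>(a : b)\<close>; it is meaningful only if \<open>(a, b) \<noteq> (0, 0)\<close>.\<close>

definition proj_pt :: "'a::field \<Rightarrow> 'a \<Rightarrow> 'a proj_line" where
  "proj_pt a b = abs_proj_line (a, b)"

lemma proj_pt_eq_iff:
  assumes "(a, b) \<noteq> (0, 0)" "(c, d) \<noteq> (0, 0)"
  shows "proj_pt a b = proj_pt c d \<longleftrightarrow> (\<exists>t. t \<noteq> 0 \<and> c = t * a \<and> d = t * b)"
proof -
  have "proj_rel (a, b) (a, b)" "proj_rel (c, d) (c, d)"
    using assms by (auto simp: proj_rel_def intro!: exI[of _ 1])
  then have "proj_pt a b = proj_pt c d \<longleftrightarrow> proj_rel (a, b) (c, d)"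
    unfolding proj_pt_def using Quotient3_rel[OF Quotient3_proj_line] by blast
  then show ?thesis
    using assms by (auto simp: proj_rel_def)
qed


section \<open>Rational functions on the projective line\<close>

text \<open>
  A rational function over \<open>k\<close> is represented by its action on the geometric points of the
  projective line; this is faithful because the algebraic closure is infinite. The pair
  \<open>(g, h)\<close> is determined up to a common scalar in \<open>k\<close>, and coprime \<open>g\<close> and \<open>h\<close> have no common
  zero other than \<open>(0, 0)\<close>, so \<open>(g(a,b) : h(a,b))\<close> is always a genuine point. The case
  \<open>h = 0\<close> is the constant function with value \<open>(1 : 0)\<close>; coprimality then forces degree 0.
\<close>

definition rational_function_of_degree ::
    "nat \<Rightarrow> ('a::field alg_closure proj_line \<Rightarrow> 'a alg_closure proj_line) \<Rightarrow> bool" where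
  "rational_function_of_degree r F \<longleftrightarrow>
     (\<exists>g h :: 'a poly poly. homogeneous r g \<and> homogeneous r h \<and> coprime g h \<and>
        (\<forall>a b. (a, b) \<noteq> (0, 0) \<longrightarrow>
           F (proj_pt a b) = proj_pt (eval_form g a b) (eval_form h a b)))"

end

theory Submission
  imports Defs
begin

text \<open>
  Put \<open>q = #k\<close> and \<open>u = f(x, 1)\<close>, irreducible of degree \<open>n = 2m + 1\<close>. A function \<open>(g : h)\<close> of degree at most
  \<open>m\<close> takes the required values iff \<open>g \<equiv> x^q h\<close> modulo \<open>u\<close> after setting \<open>y = 1\<close>. There are
  \<open>q^(2m+2)\<close> pairs \<open>(g, h)\<close> but only \<open>q^(2m+1)\<close> residues modulo \<open>u\<close>, so a nonzero solution
  exists; a common factor has degree below \<open>n\<close>, hence is prime to \<open>u\<close> and can be cancelled.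
  For two solutions, \<open>g\<^sub>1 h\<^sub>2 - g\<^sub>2 h\<^sub>1\<close> is divisible by \<open>u\<close> but has degree at most \<open>2m\<close>,
  hence vanishes.
\<close>

section \<open>Polynomials over a field\<close>

lemma map_poly_add_hom:
  assumes "h 0 = 0" "\<And>x y. h (x + y) = h x + h y"
  shows "map_poly h (p + q) = map_poly h p + map_poly h q"
  by (rule poly_eqI) (simp add: coeff_map_poly assms)

text \<open>Stated for a general \<open>h\<close> because it is applied at two levels: to
  \<open>to_ac\<close> on coefficients in \<open>k\<close>, and to \<open>map_poly to_ac\<close> on
  the coefficients of a form.\<close>

lemma map_poly_mult_hom:
  fixes h :: "'a::comm_ring_1 \<Rightarrow> 'b::comm_ring_1"
  assumes h: "h 0 = 0" "\<And>x y. h (x + y) = h x + h y" "\<And>x y. h (x * y) = h x * h y"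
  shows "map_poly h (p * q) = map_poly h p * map_poly h q"
proof (induction p)
  case (pCons a p)
  have "map_poly h (smult a q) = smult (h a) (map_poly h q)"
    by (rule poly_eqI) (simp add: coeff_map_poly h)
  with pCons show ?case
    by (simp add: map_poly_pCons map_poly_add_hom h)
qed simp

lemma poly_map_poly_hom:
  fixes h :: "'a::comm_ring_1 \<Rightarrow> 'b::comm_ring_1"
  assumes h: "h 0 = 0" "\<And>x y. h (x + y) = h x + h y" "\<And>x y. h (x * y) = h x * h y"
  shows "poly (map_poly h p) (h x) = h (poly p x)"
  by (induction p) (simp_all add: map_poly_pCons h)

text \<open>In the ideal generated by \<open>g\<close> and \<open>h\<close>, a nonzero element of
  least degree divides every element, because remainders stay in the ideal. So \<open>d\<close> is a
  greatest common divisor, not normalized.\<close>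

lemma bezout_field_poly:
  fixes g h :: "'a::field poly"
  obtains d s t where "d = s * g + t * h" "d dvd g" "d dvd h"
proof (cases "g = 0 \<and> h = 0")
  case True
  then show ?thesis using that[of 0 0 0] by simp
next
  case False
  define I where "I = {s * g + t * h |s t. True}"
  have "g = 1 * g + 0 * h" "h = 0 * g + 1 * h" by simp_all
  then have gI: "g \<in> I" and hI: "h \<in> I" unfolding I_def by blast+
  with False have "\<exists>d. d \<in> I \<and> d \<noteq> 0" by blast
  then obtain d where d: "d \<in> I" "d \<noteq> 0"
    and least: "\<And>e. e \<in> I \<and> e \<noteq> 0 \<Longrightarrow> degree d \<le> degree e"
    using ex_has_least_nat[of "\<lambda>d. d \<in> I \<and> d \<noteq> 0" _ degree] by blast
  obtain s t where st: "d = s * g + t * h" using d(1) unfolding I_def by blast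
  have "d dvd e" if e: "e \<in> I" for e
  proof -
    obtain s' t' where e': "e = s' * g + t' * h" using e unfolding I_def by blast
    have "e mod d = e - (e div d) * d" by (simp add: minus_div_mult_eq_mod)
    also have "\<dots> = (s' - (e div d) * s) * g + (t' - (e div d) * t) * h"
      by (simp only: e' st algebra_simps)
    finally have "e mod d \<in> I" unfolding I_def by blast
    then have "e mod d = 0"
      using least[of "e mod d"] degree_mod_less[OF d(2), of e] by (meson not_le)
    then show ?thesis by auto
  qed
  then show ?thesis using that st gI hI by blast
qed

section \<open>Counting polynomials of bounded degree, and the pigeonhole argument\<close>

lemma polys_below_Suc:
  "{p::'a::zero poly. \<forall>i\<ge>Suc n. coeff p i = 0} =
     (\<lambda>(a, p). pCons a p) ` (UNIV \<times> {p. \<forall>i\<ge>n. coeff p i = 0})"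
proof (intro equalityI subsetI)
  fix p :: "'a poly" assume p: "p \<in> {p. \<forall>i\<ge>Suc n. coeff p i = 0}"
  obtain a q where pq: "p = pCons a q" by (cases p)
  have "coeff q i = coeff p (Suc i)" for i by (simp add: pq)
  then have "\<forall>i\<ge>n. coeff q i = 0" using p by simp
  then show "p \<in> (\<lambda>(a, p). pCons a p) ` (UNIV \<times> {p. \<forall>i\<ge>n. coeff p i = 0})"
    using pq by auto
qed (auto simp: coeff_pCons split: nat.split)

text \<open>Splitting off the constant coefficient gives the induction. The bound is on coefficients
  rather than on \<open>degree\<close> so that \<open>n = 0\<close> leaves exactly the zero
  polynomial.\<close>

lemma
  shows finite_polys_below: "finite {p::'a::{zero,finite} poly. \<forall>i\<ge>n. coeff p i = 0}"
    and card_polys_below: "card {p::'a poly. \<forall>i\<ge>n. coeff p i = 0} = CARD('a) ^ n"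
proof (induction n)
  case 0
  have "{p::'a poly. \<forall>i\<ge>0. coeff p i = 0} = {0}" by (auto simp: poly_eq_iff)
  then show "finite {p::'a poly. \<forall>i\<ge>0. coeff p i = 0}"
    and "card {p::'a poly. \<forall>i\<ge>0. coeff p i = 0} = CARD('a) ^ 0" by simp_all
next
  case (Suc n)
  have "inj_on (\<lambda>(a, p). pCons a p) (UNIV \<times> {p::'a poly. \<forall>i\<ge>n. coeff p i = 0})"
    by (auto simp: inj_on_def)
  then show "finite {p::'a poly. \<forall>i\<ge>Suc n. coeff p i = 0}"
    and "card {p::'a poly. \<forall>i\<ge>Suc n. coeff p i = 0} = CARD('a) ^ Suc n"
    using Suc unfolding polys_below_Suc
    by (simp_all add: card_image card_cartesian_product)
qed

text \<open>A polynomial analogue of Thue's lemma, to be used with \<open>w = x^q\<close>. The bound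
  on \<open>degree u\<close> makes the pairs outnumber the residues.\<close>

lemma exists_small_congruent_pair:
  fixes u w :: "'a::{field,finite} poly"
  assumes "degree u < 2 * (m + 1)" "u \<noteq> 0"
  obtains g h where "(g, h) \<noteq> (0, 0)" "degree g \<le> m" "degree h \<le> m" "u dvd g - w * h"
proof -
  define B where "B n = {p::'a poly. \<forall>i\<ge>n. coeff p i = 0}" for n
  have fin: "finite (B n)" and card: "card (B n) = CARD('a) ^ n" for n
    unfolding B_def by (rule finite_polys_below, rule card_polys_below)
  \<comment> \<open>pigeonhole: two pairs with the same image differ by the pair sought\<close>
  define \<phi> where "\<phi> = (\<lambda>(g, h). (g - w * h) mod u)"
  have img: "\<phi> ` (B (m+1) \<times> B (m+1)) \<subseteq> B (degree u)"
    using degree_mod_less[OF assms(2)]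
    by (auto simp: \<phi>_def B_def) (metis coeff_0 coeff_eq_0 order_less_le_trans)
  have "CARD('a) > 1"
    using card_mono[of UNIV "{0, 1::'a}"] by simp
  then have "CARD('a) ^ degree u < CARD('a) ^ (2 * (m + 1))"
    using assms(1) by (rule power_strict_increasing[rotated])
  also have "\<dots> = card (B (m+1) \<times> B (m+1))"
    by (simp add: card_cartesian_product card power_add mult_2)
  finally have "\<not> inj_on \<phi> (B (m+1) \<times> B (m+1))"
    using card_inj_on_le[OF _ img fin] card[of "degree u"] by auto
  then obtain g h g' h' where *: "g \<in> B (m+1)" "h \<in> B (m+1)" "g' \<in> B (m+1)" "h' \<in> B (m+1)"
      "(g, h) \<noteq> (g', h')" "(g - w * h) mod u = (g' - w * h') mod u"
    unfolding inj_on_def \<phi>_def by auto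
  show ?thesis
  proof
    show "(g - g', h - h') \<noteq> (0, 0)" using * by auto
    show "degree (g - g') \<le> m" "degree (h - h') \<le> m"
      using * by (auto simp: B_def intro!: degree_le)
    have "u dvd (g - w * h) - (g' - w * h')"
      using *(6) by (simp add: mod_eq_dvd_iff)
    then show "u dvd (g - g') - w * (h - h')" by (simp add: algebra_simps)
  qed
qed


section \<open>Binary forms and their dehomogenizations\<close>

text \<open>The degree is a parameter because setting \<open>y = 1\<close> forgets powers of
  \<open>y\<close>. Coefficients beyond \<open>d\<close> are cut off, so this inverts
  dehomogenization only when \<open>degree u \<le> d\<close>.\<close>

definition homogenize :: "nat \<Rightarrow> 'a::comm_ring_1 poly \<Rightarrow> 'a poly poly" where
  "homogenize d u = (\<Sum>i\<le>d. monom (monom (coeff u i) i) (d - i))"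

lemma homogeneous_homogenize: "homogeneous d (homogenize d u)"
proof -
  have "i + j = d" if "coeff (coeff (homogenize d u) j) i \<noteq> 0" for i j
  proof -
    have "(\<Sum>l\<le>d. coeff (coeff (monom (monom (coeff u l) l) (d - l)) j) i) \<noteq> 0"
      using that by (simp add: homogenize_def coeff_sum)
    then obtain l where "l \<le> d" "coeff (coeff (monom (monom (coeff u l) l) (d - l)) j) i \<noteq> 0"
      by (metis (no_types, lifting) atMost_iff sum.neutral)
    then show ?thesis by (auto split: if_splits)
  qed
  then show ?thesis by (auto simp: homogeneous_def)
qed

lemma poly_homogenize_1: "degree u \<le> d \<Longrightarrow> poly (homogenize d u) 1 = u"
  by (simp add: homogenize_def poly_sum poly_monom poly_as_sum_of_monoms')

text \<open>Setting \<open>y = 1\<close> adds up the coefficients over all exponents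
  \<open>j\<close> of \<open>y\<close>; for fixed \<open>i\<close>, homogeneity leaves only
  \<open>j = d - i\<close>.\<close>

lemma coeff_dehom:
  fixes G :: "'a::comm_ring_1 poly poly"
  assumes "homogeneous d G"
  shows "coeff (poly G 1) i = (if i \<le> d then coeff (coeff G (d - i)) i else 0)"
proof -
  have "coeff (poly G 1) i = (\<Sum>j\<le>degree G. coeff (coeff G j) i)"
    by (simp add: poly_altdef coeff_sum)
  also have "\<dots> = (\<Sum>j\<in>{j. j \<le> degree G \<and> i + j = d}. coeff (coeff G j) i)"
    using assms by (intro sum.mono_neutral_right) (auto simp: homogeneous_def)
  also have "\<dots> = (if i \<le> d then coeff (coeff G (d - i)) i else 0)"
  proof (cases "i \<le> d \<and> d - i \<le> degree G")
    case True
    then have "{j. j \<le> degree G \<and> i + j = d} = {d - i}" by auto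
    with True show ?thesis by simp
  next
    case False
    then have "{j. j \<le> degree G \<and> i + j = d} = {}" by auto
    with False show ?thesis by (simp only: sum.empty) (auto simp: coeff_eq_0)
  qed
  finally show ?thesis .
qed

lemma degree_dehom_le: "homogeneous d G \<Longrightarrow> degree (poly G (1::'a::comm_ring_1 poly)) \<le> d"
  by (rule degree_le) (simp add: coeff_dehom)

text \<open>No two monomials of degree \<open>d\<close> become equal at \<open>y = 1\<close>. This
  lets identities in one variable be lifted to forms.\<close>

lemma homogeneous_eqI:
  fixes G H :: "'a::comm_ring_1 poly poly"
  assumes "homogeneous d G" "homogeneous d H" "poly G 1 = poly H 1"
  shows "G = H"
proof (intro poly_eqI)
  fix j i
  show "coeff (coeff G j) i = coeff (coeff H j) i"
  proof (cases "i + j = d")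
    case True
    then show ?thesis
      using coeff_dehom[OF assms(1), of i] coeff_dehom[OF assms(2), of i] assms(3) by auto
  next
    case False
    then show ?thesis using assms(1,2) unfolding homogeneous_def by metis
  qed
qed

lemma homogeneous_mult:
  assumes "homogeneous d G" "homogeneous e H"
  shows "homogeneous (d + e) (G * H)"
  unfolding homogeneous_def
proof (intro allI impI)
  fix i j assume "coeff (coeff (G * H) j) i \<noteq> 0"
  then have "(\<Sum>a\<le>j. \<Sum>b\<le>i. coeff (coeff G a) b * coeff (coeff H (j - a)) (i - b)) \<noteq> 0"
    by (simp add: coeff_mult coeff_sum)
  then obtain a b where ab: "a \<le> j" "b \<le> i"
      "coeff (coeff G a) b * coeff (coeff H (j - a)) (i - b) \<noteq> 0"
    by (metis (no_types, lifting) atMost_iff sum.neutral)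
  then have "b + a = d" "(i - b) + (j - a) = e"
    using assms unfolding homogeneous_def by (metis mult_zero_left mult_zero_right)+
  with ab show "i + j = d + e" by linarith
qed

lemma homogeneous_add: "homogeneous d G \<Longrightarrow> homogeneous d H \<Longrightarrow> homogeneous d (G + H)"
  unfolding homogeneous_def by (metis add.right_neutral coeff_add add_0)

lemma homogenize_mult:
  assumes "degree u \<le> d" "degree v \<le> e"
  shows "homogenize (d + e) (u * v) = homogenize d u * homogenize e v"
proof (rule homogeneous_eqI[of "d + e"])
  have "degree (u * v) \<le> d + e" using degree_mult_le[of u v] assms by linarith
  then show "poly (homogenize (d + e) (u * v)) 1 = poly (homogenize d u * homogenize e v) 1"
    using assms by (simp add: poly_homogenize_1)
qed (intro homogeneous_homogenize homogeneous_mult)+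

lemma homogeneous_conv_homogenize: "homogeneous d G \<Longrightarrow> G = homogenize d (poly G 1)"
  by (intro homogeneous_eqI[of d]) (simp_all add: homogeneous_homogenize poly_homogenize_1 degree_dehom_le)

lemma homogeneous_unit_degree:
  fixes G :: "'a::field poly poly"
  assumes "homogeneous d G" "is_unit G"
  shows "d = 0"
proof -
  obtain c where c: "G = [:c:]" "is_unit c" using assms(2) by (auto simp: is_unit_poly_iff)
  then obtain a where a: "c = [:a:]" by (auto simp: is_unit_poly_iff)
  then have "coeff (coeff G 0) 0 \<noteq> 0" using c by auto
  then have "0 + 0 = d" using assms(1) unfolding homogeneous_def by blast
  then show ?thesis by simp
qed

text \<open>The quotient has degree at most \<open>d - degree u\<close>, so homogenizing the two
  factors in complementary degrees is multiplicative.\<close>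

lemma homogenize_dvd_homogenize:
  fixes u v :: "'a::field poly"
  assumes "u dvd v" "degree v \<le> d" "degree u \<le> d"
  shows "homogenize (degree u) u dvd homogenize d v"
proof -
  obtain w where w: "v = u * w" using assms(1) by blast
  \<comment> \<open>If \<open>u = 0\<close>, then \<open>v = 0\<close> and the degree of the
    cofactor \<open>w\<close> is unconstrained.\<close>
  have "degree w \<le> d - degree u \<or> u = 0"
    using assms w by (cases "w = 0") (auto simp: degree_mult_eq)
  then show ?thesis
  proof
    assume "degree w \<le> d - degree u"
    then show ?thesis
      using homogenize_mult[of u "degree u" w "d - degree u"] w assms(3) by simp
  next
    assume "u = 0"
    then show ?thesis using w by (simp add: homogenize_def)
  qed
qed

section \<open>The form \<open>y\<close> and coprimality of homogenizations\<close>

abbreviation form_y :: "'a::comm_ring_1 poly poly" where "form_y \<equiv> [:0, 1:]"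

lemma homogeneous_form_y: "homogeneous 1 form_y"
  by (auto simp: homogeneous_def coeff_pCons split: nat.splits)

lemma not_unit_form_y: "\<not> is_unit (form_y :: 'a::field poly poly)"
  using homogeneous_unit_degree[OF homogeneous_form_y] by auto

text \<open>The only monomial of degree \<open>d\<close> without \<open>y\<close> is
  \<open>x^d\<close>, and its coefficient survives setting \<open>y = 1\<close>.\<close>

lemma form_y_dvd_iff:
  fixes G :: "'a::field poly poly"
  assumes "homogeneous d G"
  shows "form_y dvd G \<longleftrightarrow> coeff (poly G 1) d = 0"
proof -
  have "form_y dvd G \<longleftrightarrow> coeff G 0 = 0"
    using poly_eq_0_iff_dvd[of G 0] by (simp add: poly_0_coeff_0)
  also have "\<dots> \<longleftrightarrow> coeff (coeff G 0) d = 0"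
    using assms unfolding homogeneous_def poly_eq_iff by (metis add.right_neutral coeff_0)
  also have "\<dots> \<longleftrightarrow> coeff (poly G 1) d = 0"
    by (simp add: coeff_dehom[OF assms])
  finally show ?thesis .
qed

text \<open>Since \<open>y\<close> is prime and does not divide \<open>c\<close>, it divides the
  cofactor; cancelling one \<open>y\<close> at a time leaves \<open>c\<close> dividing 1.\<close>

lemma dvd_form_y_power_imp_unit:
  fixes c :: "'a::field poly poly"
  assumes "c dvd form_y ^ N" "\<not> form_y dvd c"
  shows "is_unit c"
  using assms(1)
proof (induction N)
  case (Suc N)
  obtain e where e: "form_y ^ Suc N = c * e" using Suc.prems by blast
  have c0: "poly c 0 \<noteq> 0" using assms(2) poly_eq_0_iff_dvd[of c 0] by simp
  have "poly (c * e) 0 = 0" by (simp flip: e)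
  with c0 have "poly e 0 = 0" by simp
  then obtain e' where "e = form_y * e'" using poly_eq_0_iff_dvd[of e 0] by auto
  with e have "form_y * form_y ^ N = form_y * (c * e')" by (simp only: power_Suc mult_ac)
  then have "form_y ^ N = c * e'" by (simp del: mult_pCons_left)
  then show ?case using Suc.IH by simp
qed simp

text \<open>The Bezout relation leaves only powers of \<open>y\<close> as possible common factors,
  and these are excluded because one of the two degrees equals \<open>r\<close>.\<close>

lemma coprime_homogenize:
  fixes g h :: "'a::field poly"
  assumes bez: "s * g + t * h = 1"
    and deg: "degree g \<le> r" "degree h \<le> r" "degree g = r \<or> degree h = r"
  shows "coprime (homogenize r g) (homogenize r h)"
proof (rule coprimeI)
  \<comment> \<open>homogenizing the Bezout relation shows that \<open>c\<close> divides a power of \<open>y\<close>\<close>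
  fix c assume c: "c dvd homogenize r g" "c dvd homogenize r h"
  \<comment> \<open>A common degree for \<open>s\<close> and \<open>t\<close> makes both products
    forms of degree \<open>d + r\<close>.\<close>
  define d where "d = max (degree s) (degree t)"
  have "homogenize d s * homogenize r g + homogenize d t * homogenize r h = form_y ^ (d + r)"
  proof (rule homogeneous_eqI[of "d + r"])
    show "homogeneous (d + r) (homogenize d s * homogenize r g + homogenize d t * homogenize r h)"
      by (intro homogeneous_add homogeneous_mult homogeneous_homogenize)
    have "homogeneous l (form_y ^ l :: 'a poly poly)" for l
    proof (induction l)
      case (Suc l)
      then show ?case using homogeneous_mult[OF homogeneous_form_y Suc]
        by (simp del: mult_pCons_left)
    qed (auto simp: homogeneous_def coeff_pCons one_pCons split: nat.splits)
    then show "homogeneous (d + r) (form_y ^ (d + r) :: 'a poly poly)" .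
    show "poly (homogenize d s * homogenize r g + homogenize d t * homogenize r h) 1 =
        poly (form_y ^ (d + r)) 1"
      using deg bez by (simp add: poly_homogenize_1 d_def)
  qed
  then have "c dvd form_y ^ (d + r)" using c by (metis dvd_add dvd_mult)
  moreover have "\<not> form_y dvd c"
  proof
    assume "form_y dvd c"
    then have "form_y dvd homogenize r g" "form_y dvd homogenize r h" using c dvd_trans by blast+
    then have "coeff g r = 0" "coeff h r = 0"
      using form_y_dvd_iff[OF homogeneous_homogenize, of r g] form_y_dvd_iff[OF homogeneous_homogenize, of r h]
        deg by (simp_all add: poly_homogenize_1)
    \<comment> \<open>One of the vanishing coefficients is a leading one, so that polynomial is 0
      and \<open>r = 0\<close>; the other is then a constant with vanishing constant
      coefficient.\<close>
    then have "g = 0 \<and> h = 0"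
      using deg leading_coeff_0_iff by (metis degree_0 le_zero_eq degree_eq_zeroE)
    with bez show False by simp
  qed
  ultimately show "is_unit c" by (rule dvd_form_y_power_imp_unit)
qed


section \<open>Values of forms over the algebraic closure\<close>

abbreviation ac_poly :: "'a::field poly \<Rightarrow> 'a alg_closure \<Rightarrow> 'a alg_closure" where
  "ac_poly u \<equiv> poly (map_poly to_ac u)"

lemma map_poly_to_ac_add [simp]: "map_poly to_ac (p + q) = map_poly to_ac p + map_poly to_ac q"
  by (rule map_poly_add_hom) simp_all

lemma map_poly_to_ac_diff [simp]: "map_poly to_ac (p - q) = map_poly to_ac p - map_poly to_ac q"
  by (rule poly_eqI) (simp add: coeff_map_poly)

lemma ac_poly_const [simp]: "ac_poly [:c:] a = to_ac c"
  by (simp add: map_poly_pCons)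

lemma map_poly_to_ac_mult [simp]: "map_poly to_ac (p * q) = map_poly to_ac p * map_poly to_ac q"
  by (rule map_poly_mult_hom) simp_all

lemma eval_form_mult: "eval_form (G * H) a b = eval_form G a b * eval_form H a b"
proof -
  have "map_poly (map_poly to_ac) (G * H) = map_poly (map_poly to_ac) G * map_poly (map_poly to_ac) H"
    by (rule map_poly_mult_hom) simp_all
  then show ?thesis by (simp add: eval_form_def)
qed

lemma eval_form_1: "eval_form G a 1 = ac_poly (poly G 1) a"
proof -
  have "poly (map_poly (map_poly to_ac) G) (map_poly to_ac 1) = map_poly to_ac (poly G 1)"
    by (rule poly_map_poly_hom) simp_all
  then show ?thesis by (simp add: eval_form_def flip: one_pCons)
qed

lemma eval_form_scale:
  assumes "homogeneous d G"
  shows "eval_form G (t * a) (t * b) = t ^ d * eval_form G a b"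
proof -
  \<comment> \<open>The summation bounds depend on \<open>G\<close> but not on the point, so the
    expansions at \<open>(a, b)\<close> and \<open>(t * a, t * b)\<close> can be compared term by
    term.\<close>
  define D where "D j = degree (map_poly to_ac (coeff G j))" for j
  define E where "E = degree (map_poly (map_poly to_ac) G)"
  have eval: "eval_form G a b =
      (\<Sum>j\<le>E. \<Sum>i\<le>D j. to_ac (coeff (coeff G j) i) * (a ^ i * b ^ j))" for a b
  proof -
    have "eval_form G a b = (\<Sum>j\<le>E. ac_poly (coeff G j) a * b ^ j)"
      unfolding eval_form_def poly_altdef[of _ "[:b:]"] E_def[symmetric]
      by (simp add: poly_sum coeff_map_poly)
    moreover have "ac_poly (coeff G j) a = (\<Sum>i\<le>D j. to_ac (coeff (coeff G j) i) * a ^ i)" for j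
      unfolding D_def by (simp add: poly_altdef[of _ a] coeff_map_poly)
    ultimately show ?thesis by (simp add: sum_distrib_right mult.assoc)
  qed
  have "to_ac (coeff (coeff G j) i) * ((t * a) ^ i * (t * b) ^ j) =
        t ^ d * (to_ac (coeff (coeff G j) i) * (a ^ i * b ^ j))" for i j
  proof (cases "coeff (coeff G j) i = 0")
    case False
    then have "d = i + j" using assms by (simp add: homogeneous_def)
    then show ?thesis by (simp add: power_add power_mult_distrib)
  qed simp
  then show ?thesis by (simp only: eval sum_distrib_left)
qed

text \<open>Only the monomial \<open>x^d\<close> survives at \<open>y = 0\<close>; this handles the
  point at infinity.\<close>

lemma eval_form_0:
  assumes "homogeneous d G"
  shows "eval_form G a 0 = to_ac (coeff (poly G 1) d) * a ^ d"
proof -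
  have "coeff G 0 = monom (coeff (poly G 1) d) d"
  proof (rule poly_eqI)
    fix i show "coeff (coeff G 0) i = coeff (monom (coeff (poly G 1) d) d) i"
      using assms unfolding homogeneous_def by (simp add: coeff_dehom[OF assms]) (metis add.right_neutral)
  qed
  then show ?thesis
    by (simp add: eval_form_def poly_0_coeff_0 coeff_map_poly map_poly_monom poly_monom)
qed

lemma ac_poly_eq_0_dvd: "u dvd v \<Longrightarrow> ac_poly u a = 0 \<Longrightarrow> ac_poly v a = 0"
  by auto

text \<open>A common zero at infinity would make \<open>y\<close> a common factor. At a finite point
  \<open>a / b\<close>, the gcd of the dehomogenizations would vanish, hence be nonconstant, and its
  homogenization would divide both forms.\<close>

lemma coprime_forms_no_common_zero:
  fixes G H :: "'a::field poly poly"
  assumes G: "homogeneous r G" and H: "homogeneous r H" and cop: "coprime G H"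
    and ab: "(a, b) \<noteq> (0, 0)"
  shows "(eval_form G a b, eval_form H a b) \<noteq> (0, 0)"
proof
  assume "(eval_form G a b, eval_form H a b) = (0, 0)"
  then have zero: "eval_form G a b = 0" "eval_form H a b = 0" by simp_all
  show False
  proof (cases "b = 0")
    case True
    with zero ab have "coeff (poly G 1) r = 0" "coeff (poly H 1) r = 0"
      by (auto simp: eval_form_0[OF G] eval_form_0[OF H])
    then have "form_y dvd G" "form_y dvd H"
      using form_y_dvd_iff G H by blast+
    then show False using cop not_unit_form_y coprime_common_divisor by blast
  next
    case False
    define u where "u = poly G 1"
    define v where "v = poly H 1"
    define \<alpha> where "\<alpha> = a / b"
    have *: "ac_poly u \<alpha> = 0" "ac_poly v \<alpha> = 0"
      using False zero eval_form_scale[OF G, of b \<alpha> 1] eval_form_scale[OF H, of b \<alpha> 1]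
      by (auto simp: \<alpha>_def u_def v_def eval_form_1)
    obtain d s t where d: "d = s * u + t * v" "d dvd u" "d dvd v"
      by (rule bezout_field_poly)
    have d\<alpha>: "ac_poly d \<alpha> = 0" using * by (simp add: d(1))
    have nz: "G \<noteq> 0 \<or> H \<noteq> 0" using cop by auto
    then have "u \<noteq> 0 \<or> v \<noteq> 0"
      using homogeneous_eqI[OF G, of 0] homogeneous_eqI[OF H, of 0]
      by (auto simp: u_def v_def homogeneous_def)
    then have d0: "d \<noteq> 0" using d by auto
    have deg: "degree d > 0"
    proof (rule ccontr)
      assume "\<not> degree d > 0"
      then obtain c where "d = [:c:]" by (metis degree_eq_zeroE gr_zeroI)
      then show False using d0 d\<alpha> by simp
    qed
    have le: "degree u \<le> r" "degree v \<le> r"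
      using degree_dehom_le G H by (auto simp: u_def v_def)
    have "degree d \<le> r"
      using \<open>u \<noteq> 0 \<or> v \<noteq> 0\<close> le dvd_imp_degree_le[OF d(2)] dvd_imp_degree_le[OF d(3)] by auto
    then have "homogenize (degree d) d dvd G" "homogenize (degree d) d dvd H"
      using homogenize_dvd_homogenize[OF d(2) le(1)] homogenize_dvd_homogenize[OF d(3) le(2)]
      by (simp_all add: u_def v_def flip: homogeneous_conv_homogenize[OF G] homogeneous_conv_homogenize[OF H])
    then have "is_unit (homogenize (degree d) d)" using cop coprime_common_divisor by blast
    then show False using homogeneous_unit_degree[OF homogeneous_homogenize, of "degree d" d] deg by simp
  qed
qed

section \<open>Irreducible forms and their roots\<close>

text \<open>Factors in one variable homogenize to factors of \<open>f\<close>. The bound on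
  \<open>n\<close> excludes \<open>f = y\<close>, whose dehomogenization is constant.\<close>

lemma irreducible_dehom:
  fixes f :: "'a::field poly poly"
  assumes irr: "irreducible f" and f: "homogeneous n f" and n: "n \<ge> 2"
  shows "degree (poly f 1) = n"
    and "\<And>v w. poly f 1 = v * w \<Longrightarrow> degree v = 0 \<or> degree w = 0"
proof -
  define u where "u = poly f 1"
  \<comment> \<open>otherwise \<open>y\<close> would be a proper factor of \<open>f\<close>\<close>
  have "coeff u n \<noteq> 0"
  proof
    assume "coeff u n = 0"
    have le: "degree u \<le> n - 1"
    proof (intro degree_le allI impI)
      fix i assume "i > n - 1"
      then consider "i = n" | "i > degree u"
        using degree_dehom_le[OF f] by (fastforce simp: u_def)
      then show "coeff u i = 0"
        using \<open>coeff u n = 0\<close> by cases (auto simp: coeff_eq_0)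
    qed
    \<comment> \<open>Counting the constant 1 as a polynomial of degree at most 1 produces the
      factor \<open>homogenize 1 1\<close>, which is \<open>y\<close>.\<close>
    have "f = homogenize n (1 * u)" by (simp add: u_def flip: homogeneous_conv_homogenize[OF f])
    also have "\<dots> = homogenize 1 1 * homogenize (n - 1) u"
      using homogenize_mult[of 1 1 u "n - 1"] le n by simp
    finally have "is_unit (homogenize 1 (1 :: 'a poly)) \<or> is_unit (homogenize (n - 1) u)"
      by (rule irreducibleD[OF irr])
    then have "(1::nat) = 0 \<or> n - 1 = 0"
      by (elim disj_forward homogeneous_unit_degree[OF homogeneous_homogenize])
    then show False using n by simp
  qed
  then show deg: "degree (poly f 1) = n"
    using degree_dehom_le[OF f] le_degree u_def by (metis antisym)
  fix v w assume vw: "poly f 1 = v * w"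
  then have nz: "v \<noteq> 0" "w \<noteq> 0" using deg n by auto
  then have "n = degree v + degree w" using deg vw by (simp add: degree_mult_eq)
  then have "f = homogenize (degree v + degree w) (v * w)"
    using homogeneous_conv_homogenize[OF f] by (simp only: vw)
  then have "f = homogenize (degree v) v * homogenize (degree w) w" by (simp add: homogenize_mult)
  then have "is_unit (homogenize (degree v) v) \<or> is_unit (homogenize (degree w) w)"
    by (rule irreducibleD[OF irr])
  then show "degree v = 0 \<or> degree w = 0"
    by (elim disj_forward homogeneous_unit_degree[OF homogeneous_homogenize])
qed

text \<open>Up to a scalar, \<open>u\<close> is the minimal polynomial of \<alpha>: the gcd of
  \<open>u\<close> and \<open>w\<close> vanishes at \<alpha>, so it is nonconstant and therefore
  associated to \<open>u\<close>.\<close>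

lemma dvd_if_common_root:
  fixes u w :: "'a::field poly"
  assumes irr: "\<forall>v w. u = v * w \<longrightarrow> degree v = 0 \<or> degree w = 0" and u: "u \<noteq> 0"
    and root: "ac_poly u \<alpha> = 0" "ac_poly w \<alpha> = 0"
  shows "u dvd w"
proof -
  obtain d s t where d: "d = s * u + t * w" "d dvd u" "d dvd w" by (rule bezout_field_poly)
  obtain e where e: "u = d * e" using d(2) by blast
  have "ac_poly d \<alpha> = 0" using root by (simp add: d(1))
  moreover have "d \<noteq> 0" using e u by auto
  ultimately have "degree d \<noteq> 0" by (metis degree_eq_zeroE ac_poly_const to_ac_eq_0_iff pCons_0_0)
  then have "degree e = 0" using irr[rule_format, OF e] by simp
  moreover have "e \<noteq> 0" using e u by auto
  ultimately have "is_unit e" by (simp add: is_unit_iff_degree)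
  then show ?thesis using e d(3) by (simp add: mult_unit_dvd_iff)
qed


section \<open>Points of the projective line\<close>

text \<open>In the partial quotient only nonzero pairs are related to themselves, so every point has
  a genuine representative.\<close>

lemma proj_line_cases:
  obtains a b where "(a, b) \<noteq> (0, 0)" "P = proj_pt a b"
proof -
  obtain z where z: "proj_rel z z" "P = abs_proj_line z"
    using Quotient3_abs_rep[OF Quotient3_proj_line] Quotient3_rep_reflp[OF Quotient3_proj_line]
    by metis
  then show ?thesis using that[of "fst z" "snd z"]
    by (auto simp: proj_pt_def proj_rel_def)
qed

text \<open>Proportionality as a vanishing determinant, which turns equalities of points into
  polynomial equations.\<close>

lemma proj_pt_eq_iff_cross:
  assumes "(a, b) \<noteq> (0, 0)" "(c, d) \<noteq> (0, 0)"
  shows "proj_pt a b = proj_pt c d \<longleftrightarrow> a * d = c * b"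
proof
  assume "a * d = c * b"
  show "proj_pt a b = proj_pt c d"
  proof (cases "a = 0")
    case True
    with assms \<open>a * d = c * b\<close> show ?thesis
      by (subst proj_pt_eq_iff) (auto intro!: exI[of _ "d / b"])
  next
    case False
    with assms \<open>a * d = c * b\<close> show ?thesis
      by (subst proj_pt_eq_iff) (auto intro!: exI[of _ "c / a"] simp: field_simps)
  qed
qed (use assms in \<open>auto simp: proj_pt_eq_iff\<close>)

text \<open>The choice of representative is harmless: scaling it by \<open>t\<close> multiplies both
  values by \<open>t ^ r\<close>, and the values never vanish together.\<close>

lemma rational_function_exists:
  fixes g h :: "'a::field poly poly"
  assumes g: "homogeneous r g" and h: "homogeneous r h" and cop: "coprime g h"
  obtains F where "\<And>a b. (a, b) \<noteq> (0, 0) \<Longrightarrow>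
    F (proj_pt a b) = proj_pt (eval_form g a b) (eval_form h a b)"
proof -
  define F where "F P = (SOME Q. \<exists>a b. (a, b) \<noteq> (0, 0) \<and> P = proj_pt a b \<and>
    Q = proj_pt (eval_form g a b) (eval_form h a b))" for P
  show ?thesis
  proof
    fix a b :: "'a alg_closure" assume ab: "(a, b) \<noteq> (0, 0)"
    then have "\<exists>Q. \<exists>a' b'. (a', b') \<noteq> (0, 0) \<and> proj_pt a b = proj_pt a' b' \<and>
        Q = proj_pt (eval_form g a' b') (eval_form h a' b')" by blast
    from someI_ex[OF this] obtain a' b' where *: "(a', b') \<noteq> (0, 0)" "proj_pt a b = proj_pt a' b'"
        "F (proj_pt a b) = proj_pt (eval_form g a' b') (eval_form h a' b')"
      unfolding F_def by blast
    then obtain t where "a' = t * a" "b' = t * b"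
      using ab by (auto simp: proj_pt_eq_iff)
    then have "proj_pt (eval_form g a' b') (eval_form h a' b') =
        proj_pt (eval_form g a b) (eval_form h a b)"
      using coprime_forms_no_common_zero[OF g h cop *(1)] coprime_forms_no_common_zero[OF g h cop ab]
      by (subst proj_pt_eq_iff_cross) (auto simp: eval_form_scale[OF g] eval_form_scale[OF h])
    with * show "F (proj_pt a b) = proj_pt (eval_form g a b) (eval_form h a b)" by simp
  qed
qed

section \<open>Existence and uniqueness of the interpolating function\<close>

text \<open>A common factor of \<open>g\<close> and \<open>h\<close> can be cancelled from the
  congruence modulo \<open>u\<close>. Coprimality is given as a Bezout relation because that is the
  form which homogenizes.\<close>

lemma exists_coprime_interpolant:
  fixes u w :: "'a::{field,finite} poly"
  assumes irr: "\<forall>v w. u = v * w \<longrightarrow> degree v = 0 \<or> degree w = 0"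
    and deg: "m < degree u" "degree u < 2 * (m + 1)"
  obtains g h s t where "s * g + t * h = 1" "degree g \<le> m" "degree h \<le> m" "u dvd g - w * h"
proof -
  define P where "P = (\<lambda>(g, h). (g, h) \<noteq> (0, 0) \<and> degree g \<le> m \<and> degree h \<le> m \<and> u dvd g - w * h)"
  have u: "u \<noteq> 0" using deg by auto
  obtain g\<^sub>0 h\<^sub>0 where "P (g\<^sub>0, h\<^sub>0)"
    unfolding P_def case_prod_conv
    by (rule exists_small_congruent_pair[OF deg(2) u, of w]) blast
  \<comment> \<open>a pair of least degree has no common factor of positive degree\<close>
  then obtain x where "P x"
      and least: "\<And>y. P y \<Longrightarrow> max (degree (fst x)) (degree (snd x)) \<le> max (degree (fst y)) (degree (snd y))"
    using ex_has_least_nat[of P _ "\<lambda>x. max (degree (fst x)) (degree (snd x))"] by blast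
  then obtain g h where x: "x = (g, h)" and gh: "(g, h) \<noteq> (0, 0)" "degree g \<le> m" "degree h \<le> m"
      "u dvd g - w * h"
    by (cases x) (auto simp: P_def)
  obtain d s t where d: "d = s * g + t * h" "d dvd g" "d dvd h" by (rule bezout_field_poly)
  obtain g' h' where g': "g = d * g'" and h': "h = d * h'" using d(2,3) by blast
  have d0: "d \<noteq> 0" using gh g' h' by auto
  have dm: "degree d \<le> m" using gh(1-3) dvd_imp_degree_le[OF d(2)] dvd_imp_degree_le[OF d(3)] by auto
  have "\<exists>\<alpha>. ac_poly u \<alpha> = 0"
    using deg by (intro alg_closed_imp_poly_has_root) (simp add: degree_map_poly)
  then obtain \<alpha> where \<alpha>: "ac_poly u \<alpha> = 0" ..
  \<comment> \<open>The factor \<open>d\<close> has smaller degree than \<open>u\<close>, so it is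
    nonzero at a root of \<open>u\<close> and can be cancelled there.\<close>
  have "ac_poly d \<alpha> \<noteq> 0"
  proof
    assume "ac_poly d \<alpha> = 0"
    then have "u dvd d" by (rule dvd_if_common_root[OF irr u \<alpha>])
    then show False using dvd_imp_degree_le[of u d] d0 dm deg(1) by simp
  qed
  moreover have "ac_poly (d * (g' - w * h')) \<alpha> = 0"
    using ac_poly_eq_0_dvd[OF gh(4) \<alpha>] by (simp add: g' h' algebra_simps)
  ultimately have "ac_poly (g' - w * h') \<alpha> = 0" by simp
  then have u': "u dvd g' - w * h'" by (rule dvd_if_common_root[OF irr u \<alpha>])
  have dg: "degree g' = degree g - degree d" "degree h' = degree h - degree d"
    using d0 by (cases "g' = 0"; cases "h' = 0"; simp add: g' h' degree_mult_eq)+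
  have "P (g', h')"
    using gh u' dg g' h' by (auto simp: P_def)
  from least[OF this] have "max (degree g) (degree h) \<le> max (degree g - degree d) (degree h - degree d)"
    by (simp add: x dg)
  \<comment> \<open>Subtraction is truncated, so without this bound the preceding inequality would
    allow \<open>degree d > 0\<close> when the maximum is 0.\<close>
  moreover have "degree d \<le> max (degree g) (degree h)"
    using gh(1) dvd_imp_degree_le[OF d(2)] dvd_imp_degree_le[OF d(3)] by auto
  ultimately have "degree d = 0" by linarith
  then obtain c where c: "d = [:c:]" "c \<noteq> 0" using d0 by (auto elim!: degree_eq_zeroE)
  have "[:inverse c:] * s * g + [:inverse c:] * t * h = [:inverse c:] * d"
    by (simp only: d(1) algebra_simps)
  also have "\<dots> = 1" using c by (simp add: one_pCons)
  finally show ?thesis using that gh by blast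
qed

theorem theorem2p1:
  fixes f :: "'k :: {field, finite} poly poly" and n :: nat
  assumes "irreducible f" and "homogeneous n f" and "n \<ge> 3" and "odd n"
  shows "\<exists>!F :: 'k alg_closure proj_line \<Rightarrow> 'k alg_closure proj_line.
           (\<exists>r \<le> (n - 1) div 2. rational_function_of_degree r F) \<and>
           (\<forall>\<alpha>. form_root f \<alpha> \<longrightarrow>
                proj_pt (\<alpha> ^ CARD('k)) 1 = F (proj_pt \<alpha> 1))"
proof -
  define m where "m = (n - 1) div 2"
  have m: "n = 2 * m + 1" using assms(3,4) by (auto simp: m_def elim!: oddE)
  define u where "u = poly f 1"
  have irr: "\<forall>v w. u = v * w \<longrightarrow> degree v = 0 \<or> degree w = 0"
    using irreducible_dehom(2)[OF assms(1,2)] assms(3) unfolding u_def by simp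
  have degu: "degree u = n"
    using irreducible_dehom(1)[OF assms(1,2)] assms(3) by (simp add: u_def)
  then have u0: "u \<noteq> 0" using assms(3) by auto
  have root_iff: "form_root f \<alpha> \<longleftrightarrow> ac_poly u \<alpha> = 0" for \<alpha>
    by (simp add: form_root_def eval_form_1 u_def)
  \<comment> \<open>Coprime forms have no common zero, so the right-hand pair is a genuine point and
    cross-multiplication is an equivalence.\<close>
  have value_iff: "proj_pt (\<alpha> ^ q) 1 = proj_pt (eval_form g \<alpha> 1) (eval_form h \<alpha> 1) \<longleftrightarrow>
      ac_poly (poly g 1) \<alpha> = \<alpha> ^ q * ac_poly (poly h 1) \<alpha>"
    if "homogeneous r g" "homogeneous r h" "coprime g h"
    for g h :: "'k poly poly" and r q :: nat and \<alpha>
    using coprime_forms_no_common_zero[OF that, of \<alpha> 1]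
    by (subst proj_pt_eq_iff_cross) (auto simp: eval_form_1)
  show ?thesis
  proof (rule ex_ex1I)
    \<comment> \<open>Both bounds come from \<open>n = 2 * m + 1\<close>: the lower one allows
      cancelling common factors, the upper one serves the pigeonhole argument.\<close>
    have bounds: "m < degree u" "degree u < 2 * (m + 1)" using degu m by simp_all
    obtain g h s t where gh: "s * g + t * h = 1" "degree g \<le> m" "degree h \<le> m"
        "u dvd g - monom 1 CARD('k) * h"
      by (rule exists_coprime_interpolant[OF irr bounds, of "monom 1 CARD('k)"])
    \<comment> \<open>The degree must be attained: homogenizing in degree \<open>m\<close> would
      introduce a common factor \<open>y\<close> if both degrees were smaller.\<close>
    define r where "r = max (degree g) (degree h)"
    have r: "degree g \<le> r" "degree h \<le> r" "degree g = r \<or> degree h = r" "r \<le> m"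
      using gh by (auto simp: r_def)
    note forms = homogeneous_homogenize[of r g] homogeneous_homogenize[of r h] coprime_homogenize[OF gh(1) r(1-3)]
    obtain F where F: "\<And>a b. (a, b) \<noteq> (0, 0) \<Longrightarrow>
        F (proj_pt a b) = proj_pt (eval_form (homogenize r g) a b) (eval_form (homogenize r h) a b)"
      using rational_function_exists[OF forms] by blast
    have "rational_function_of_degree r F"
      unfolding rational_function_of_degree_def using forms F by blast
    moreover have "proj_pt (\<alpha> ^ CARD('k)) 1 = F (proj_pt \<alpha> 1)" if "form_root f \<alpha>" for \<alpha>
    proof -
      have "ac_poly (g - monom 1 CARD('k) * h) \<alpha> = 0"
        using ac_poly_eq_0_dvd[OF gh(4)] that root_iff by blast
      then show ?thesis
        using r by (simp add: F value_iff[OF forms] poly_homogenize_1 map_poly_monom poly_monom)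
    qed
    ultimately show "\<exists>F. (\<exists>r \<le> (n - 1) div 2. rational_function_of_degree r F) \<and>
        (\<forall>\<alpha>. form_root f \<alpha> \<longrightarrow> proj_pt (\<alpha> ^ CARD('k)) 1 = F (proj_pt \<alpha> 1))"
      using r(4) unfolding m_def by blast
  next
    fix F\<^sub>1 F\<^sub>2 :: "'k alg_closure proj_line \<Rightarrow> 'k alg_closure proj_line"
    assume A\<^sub>1: "(\<exists>r \<le> (n - 1) div 2. rational_function_of_degree r F\<^sub>1) \<and>
        (\<forall>\<alpha>. form_root f \<alpha> \<longrightarrow> proj_pt (\<alpha> ^ CARD('k)) 1 = F\<^sub>1 (proj_pt \<alpha> 1))"
      and A\<^sub>2: "(\<exists>r \<le> (n - 1) div 2. rational_function_of_degree r F\<^sub>2) \<and>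
        (\<forall>\<alpha>. form_root f \<alpha> \<longrightarrow> proj_pt (\<alpha> ^ CARD('k)) 1 = F\<^sub>2 (proj_pt \<alpha> 1))"
    obtain r\<^sub>1 g\<^sub>1 h\<^sub>1 where r1: "r\<^sub>1 \<le> m"
      and 1: "homogeneous r\<^sub>1 g\<^sub>1" "homogeneous r\<^sub>1 h\<^sub>1" "coprime g\<^sub>1 h\<^sub>1"
      and F1: "\<And>a b. (a, b) \<noteq> (0, 0) \<Longrightarrow>
          F\<^sub>1 (proj_pt a b) = proj_pt (eval_form g\<^sub>1 a b) (eval_form h\<^sub>1 a b)"
      using A\<^sub>1 unfolding rational_function_of_degree_def m_def by blast
    obtain r\<^sub>2 g\<^sub>2 h\<^sub>2 where r2: "r\<^sub>2 \<le> m"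
      and 2: "homogeneous r\<^sub>2 g\<^sub>2" "homogeneous r\<^sub>2 h\<^sub>2" "coprime g\<^sub>2 h\<^sub>2"
      and F2: "\<And>a b. (a, b) \<noteq> (0, 0) \<Longrightarrow>
          F\<^sub>2 (proj_pt a b) = proj_pt (eval_form g\<^sub>2 a b) (eval_form h\<^sub>2 a b)"
      using A\<^sub>2 unfolding rational_function_of_degree_def m_def by blast
    define w where "w = poly (g\<^sub>1 * h\<^sub>2) 1 - poly (g\<^sub>2 * h\<^sub>1) 1"
    have H: "homogeneous (r\<^sub>1 + r\<^sub>2) (g\<^sub>1 * h\<^sub>2)" "homogeneous (r\<^sub>1 + r\<^sub>2) (g\<^sub>2 * h\<^sub>1)"
      using homogeneous_mult[OF 1(1) 2(2)] homogeneous_mult[OF 2(1) 1(2)] by (simp_all add: add.commute)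
    \<comment> \<open>A single root suffices for uniqueness: by irreducibility, vanishing of
      \<open>w\<close> there already gives divisibility by \<open>u\<close>.\<close>
    have "\<exists>\<alpha>. ac_poly u \<alpha> = 0"
      using degu assms(3) by (intro alg_closed_imp_poly_has_root) (simp add: degree_map_poly)
    then obtain \<alpha> where \<alpha>: "ac_poly u \<alpha> = 0" ..
    then have "form_root f \<alpha>" by (simp add: root_iff)
    then have
        "proj_pt (\<alpha> ^ CARD('k)) 1 = proj_pt (eval_form g\<^sub>1 \<alpha> 1) (eval_form h\<^sub>1 \<alpha> 1)"
        "proj_pt (\<alpha> ^ CARD('k)) 1 = proj_pt (eval_form g\<^sub>2 \<alpha> 1) (eval_form h\<^sub>2 \<alpha> 1)"
      using A\<^sub>1 A\<^sub>2 F1[of \<alpha> 1] F2[of \<alpha> 1] by auto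
    then have "ac_poly w \<alpha> = 0"
      unfolding value_iff[OF 1] value_iff[OF 2] by (simp add: w_def)
    then have "u dvd w" by (rule dvd_if_common_root[OF irr u0 \<alpha>])
    moreover have "degree w \<le> r\<^sub>1 + r\<^sub>2"
      unfolding w_def using H by (intro degree_diff_le degree_dehom_le)
    ultimately have "w = 0"
      using dvd_imp_degree_le[of u w] degu m r1 r2 by linarith
    then have eq: "g\<^sub>1 * h\<^sub>2 = g\<^sub>2 * h\<^sub>1"
      by (intro homogeneous_eqI[OF H]) (simp add: w_def)
    show "F\<^sub>1 = F\<^sub>2"
    proof (rule ext)
      fix P :: "'k alg_closure proj_line"
      obtain a b where ab: "(a, b) \<noteq> (0, 0)" "P = proj_pt a b" by (rule proj_line_cases)
      \<comment> \<open>The identity of forms holds at every geometric point, including the one at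
        infinity.\<close>
      have "eval_form g\<^sub>1 a b * eval_form h\<^sub>2 a b = eval_form g\<^sub>2 a b * eval_form h\<^sub>1 a b"
        using eq by (metis eval_form_mult)
      then show "F\<^sub>1 P = F\<^sub>2 P"
        using ab coprime_forms_no_common_zero[OF 1 ab(1)] coprime_forms_no_common_zero[OF 2 ab(1)]
        by (simp add: F1 F2 proj_pt_eq_iff_cross)
    qed
  qed
qed

end
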